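(* Let $\mathcal{A}\in T_{m,n}$, $q\in\mathbb{R}^n$, $p\in(0,1)$, $t>0$, and consider the problem $$\min_{u\in\mathbb{R}^n} f(u)=\tfrac12\|\Phi_{FB}(u)\|^2+t\|u\|_p^p .$$ Let $u^*$ be a local minimizer of this problem that satisfies $f(u^* )\le f(u_0)$ for a given arbitrary initial point $u_0\in\mathbb{R}^n$. If $$t\le\frac{2\|\tilde q\|^2}{\|\bar u\|_p^p}$$ for some nonzero vector $\bar u\in\mathrm{SOL}(q,\mathcal{A})$, then $0$ is not a global minimizer of this problem.
   Context: $T_{m,n}$ is the set of real tensors $\mathcal{A}=(a_{i_1\ldots i_m})$ of order $m\ge 2$ and dimension $n$. For $u\in\mathbb{R}^n$, $\mathcal{A}u^{m-1}\in\mathbb{R}^n$ is the vector with $(\mathcal{A}u^{m-1})_i=\sum_{i_2,\ldots,i_m=1}^n a_{i i_2\ldots i_m}u_{i_2}\cdots u_{i_m}$. $\mathrm{SOL}(q,\mathcal{A})=\{u\in\mathbb{R}^n: u\ge 0,\ \mathcal{A}u^{m-1}+q\ge 0,\ u^T(\mathcal{A}u^{m-1}+q)=0\}$ (componentwise inequalities) is the solution set of the tensor complementarity problem $\mathrm{TCP}(q,\mathcal{A})$. The Fischer-Burmeister function is $\phi_{FB}(a,b)=\sqrt{a^2+b^2}-(a+b)$ for $a,b\in\mathbb{R}$, and $\Phi_{FB}:\mathbb{R}^n\to\mathbb{R}^n$ is defined by $\Phi_{FB}(u)_i=\phi_{FB}(u_i,(q+\mathcal{A}u^{m-1})_i)$,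 $i=1,\ldots,n$. $\tilde q=-\min\{0,q\}$ with the minimum taken componentwise. $\|\cdot\|$ is the Euclidean norm and $\|u\|_p^p=\sum_{i=1}^n|u_i|^p$. *)

theory Defs
  imports "HOL-Analysis.Analysis"
begin

text \<open>
  A tensor of order \<open>m\<close> and dimension \<open>CARD('n)\<close> maps index tuples, encoded as lists of
  length \<open>m\<close> over \<open>'n\<close>, to its real entries; it is \<open>undefined\<close> on lists of other lengths,
  so that distinct functions in \<open>tensors m\<close> are distinct tensors.
\<close>

definition tensors :: "nat \<Rightarrow> ('n::finite list \<Rightarrow> real) set" where
  "tensors m = {is. length is = m} \<rightarrow>\<^sub>E UNIV"

text \<open>\<open>tensor_apply m A u\<close> is the vector \<open>A u\<^sup>m\<^sup>-\<^sup>1\<close>; the list \<open>js\<close> is \<open>(i\<^sub>2, \<dots>, i\<^sub>m)\<close>.\<close>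

definition tensor_apply ::
  "nat \<Rightarrow> ('n::finite list \<Rightarrow> real) \<Rightarrow> real ^ 'n \<Rightarrow> real ^ 'n" where
  "tensor_apply m A u =
     (\<chi> i. \<Sum>js\<in>{js. length js = m - 1}. A (i # js) * (\<Prod>j\<leftarrow>js. u $ j))"

text \<open>The order on \<open>real ^ 'n\<close> is componentwise.\<close>

definition SOL :: "nat \<Rightarrow> real ^ 'n \<Rightarrow> ('n::finite list \<Rightarrow> real) \<Rightarrow> (real ^ 'n) set" where
  "SOL m q A =
     {u. 0 \<le> u \<and> 0 \<le> tensor_apply m A u + q \<and> u \<bullet> (tensor_apply m A u + q) = 0}"

definition phi_FB :: "real \<Rightarrow> real \<Rightarrow> real" where
  "phi_FB a b = sqrt (a\<^sup>2 + b\<^sup>2) - (a + b)"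

definition Phi_FB ::
  "nat \<Rightarrow> real ^ 'n \<Rightarrow> ('n::finite list \<Rightarrow> real) \<Rightarrow> real ^ 'n \<Rightarrow> real ^ 'n" where
  "Phi_FB m q A u = (\<chi> i. phi_FB (u $ i) ((q + tensor_apply m A u) $ i))"

definition q_tilde :: "real ^ 'n \<Rightarrow> real ^ 'n::finite" where
  "q_tilde q = - (\<chi> i. min 0 (q $ i))"

text \<open>\<open>lp_pow p u\<close> is \<open>\<parallel>u\<parallel>\<^sub>p\<^sup>p\<close>. Since \<open>0 powr p = 0\<close>, zero components contribute \<open>0\<close>.\<close>

definition lp_pow :: "real \<Rightarrow> real ^ 'n::finite \<Rightarrow> real" where
  "lp_pow p u = (\<Sum>i\<in>UNIV. \<bar>u $ i\<bar> powr p)"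

definition objective ::
  "nat \<Rightarrow> ('n::finite list \<Rightarrow> real) \<Rightarrow> real ^ 'n \<Rightarrow> real \<Rightarrow> real \<Rightarrow> real ^ 'n \<Rightarrow> real" where
  "objective m A q p t u = 1 / 2 * (norm (Phi_FB m q A u))\<^sup>2 + t * lp_pow p u"

definition local_minimizer :: "('a::topological_space \<Rightarrow> real) \<Rightarrow> 'a \<Rightarrow> bool" where
  "local_minimizer f x \<longleftrightarrow> (\<forall>\<^sub>F y in nhds x. f x \<le> f y)"

definition global_minimizer :: "('a \<Rightarrow> real) \<Rightarrow> 'a \<Rightarrow> bool" where
  "global_minimizer f x \<longleftrightarrow> (\<forall>y. f x \<le> f y)"

end

theory Submission
  imports Defs
begin

text \<open>
  At the origin the objective equals \<open>2 \<parallel>q_tilde q\<parallel>\<^sup>2\<close> (\<open>objective_zero\<close>), while at a solution \<open>u\<close> of the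
  complementarity problem the residual vanishes and only \<open>t \<parallel>u\<parallel>\<^sub>p\<^sup>p\<close> remains. The bound on \<open>t\<close>
  therefore says exactly that the objective at \<open>ubar\<close> is at most its value at the origin.

  This comparison alone is not enough, since it allows equality. But a nonzero solution is never a
  minimizer (\<open>SOL_strict_descent\<close>): replacing \<open>u\<close> by \<open>(1 - e) u\<close> changes the arguments
  of the Lipschitz function \<open>phi_FB\<close> by \<open>O(e)\<close>, so that the squared residual becomes only
  \<open>O(e\<^sup>2)\<close>, whereas the penalty \<open>t \<parallel>u\<parallel>\<^sub>p\<^sup>p\<close> drops by at least \<open>p e t \<parallel>u\<parallel>\<^sub>p\<^sup>p\<close>, which is of
  first order. For small \<open>e > 0\<close> the point \<open>(1 - e) ubar\<close> hence lies strictly below the origin.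
\<close>

lemma tensor_apply_scaleR:
  "tensor_apply m A (s *\<^sub>R u) = s ^ (m - 1) *\<^sub>R tensor_apply m A u"
proof -
  have prod: "(\<Prod>j\<leftarrow>js. s * u $ j) = s ^ length js * (\<Prod>j\<leftarrow>js. u $ j)" for js :: "'a list"
    by (induction js) auto
  show ?thesis
    by (auto simp: tensor_apply_def vec_eq_iff prod sum_distrib_left algebra_simps intro!: sum.cong)
qed

lemma phi_FB_Lipschitz:
  "\<bar>phi_FB a b - phi_FB c d\<bar> \<le> 2 * (\<bar>a - c\<bar> + \<bar>b - d\<bar>)"
proof -
  have "\<bar>norm (a, b) - norm (c, d)\<bar> \<le> norm ((a, b) - (c, d))"
    by (rule norm_triangle_ineq3)
  also have "\<dots> \<le> \<bar>a - c\<bar> + \<bar>b - d\<bar>"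
    by (simp add: norm_Pair sqrt_sum_squares_le_sum_abs)
  finally show ?thesis
    unfolding phi_FB_def norm_Pair real_norm_def power2_abs by (smt (verit))
qed

lemma phi_FB_eq_0:
  assumes "0 \<le> a" "0 \<le> b" "a * b = 0"
  shows "phi_FB a b = 0"
  using assms by (auto simp: phi_FB_def)

lemma SOL_componentwise:
  assumes "u \<in> SOL m q A"
  shows "0 \<le> u $ i" "0 \<le> q $ i + tensor_apply m A u $ i"
    and "u $ i * (q $ i + tensor_apply m A u $ i) = 0"
proof -
  let ?w = "tensor_apply m A u"
  have nn: "0 \<le> u $ j" "0 \<le> q $ j + ?w $ j" for j
    using assms by (auto simp: SOL_def less_eq_vec_def add.commute)
  have "(\<Sum>j\<in>UNIV. u $ j * (q $ j + ?w $ j)) = 0"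
    using assms by (simp add: SOL_def inner_vec_def add.commute)
  then show "u $ i * (q $ i + ?w $ i) = 0"
    using nn by (subst (asm) sum_nonneg_eq_0_iff) auto
  show "0 \<le> u $ i" "0 \<le> q $ i + ?w $ i"
    using nn by auto
qed

lemma Phi_FB_SOL:
  assumes "u \<in> SOL m q A"
  shows "Phi_FB m q A u = 0"
  using SOL_componentwise[OF assms] by (simp add: Phi_FB_def vec_eq_iff phi_FB_eq_0)

lemma objective_SOL:
  assumes "u \<in> SOL m q A"
  shows "objective m A q p t u = t * lp_pow p u"
  by (simp add: objective_def Phi_FB_SOL[OF assms])

text \<open>
  For order one, \<open>A u\<^sup>m\<^sup>-\<^sup>1\<close> is a constant vector, which need not vanish at the origin;
  this is why \<open>m \<ge> 2\<close> appears. Otherwise \<open>\<bar>x\<bar> - x = - 2 min 0 x\<close> gives the claim.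
\<close>

lemma objective_zero:
  assumes "m \<ge> 2"
  shows "objective m A q p t 0 = 2 * (norm (q_tilde q))\<^sup>2"
proof -
  have "tensor_apply m A 0 = 0"
    using tensor_apply_scaleR[of m A 0 0] assms by (simp add: power_0_left)
  then have "Phi_FB m q A 0 = 2 *\<^sub>R q_tilde q"
    by (auto simp: Phi_FB_def phi_FB_def q_tilde_def vec_eq_iff)
  moreover have "lp_pow p (0 :: real ^ 'a) = 0"
    by (simp add: lp_pow_def)
  ultimately show ?thesis
    by (simp add: objective_def power_mult_distrib)
qed

lemma lp_pow_pos:
  assumes "u \<noteq> 0"
  shows "0 < lp_pow p u"
proof -
  obtain i where "u $ i \<noteq> 0"
    using assms by (auto simp: vec_eq_iff)
  then show ?thesis
    unfolding lp_pow_def by (intro sum_pos2[of _ i]) auto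
qed

lemma lp_pow_scaleR:
  "lp_pow p (s *\<^sub>R u) = \<bar>s\<bar> powr p * lp_pow p u"
  by (simp add: lp_pow_def abs_mult powr_mult sum_distrib_left)

text \<open>
  This is Bernoulli's inequality for an exponent below one. It is the instance of Young's
  inequality \<open>a\<^sup>p b\<^sup>1\<^sup>-\<^sup>p \<le> p a + (1 - p) b\<close> with \<open>a = 1 - e\<close> and \<open>b = 1\<close>.
\<close>

lemma one_minus_powr_le:
  fixes p e :: real
  assumes "0 < p" "p < 1" "0 \<le> e" "e < 1"
  shows "(1 - e) powr p \<le> 1 - p * e"
  using Youngs_inequality_0[of p "1 - p" "1 - e" 1] assms by (simp add: algebra_simps)

text \<open>
  The residual vanishes at a solution, and along the segment towards the origin the arguments of
  \<open>phi_FB\<close> move at bounded speed: \<open>u\<close> linearly and \<open>A u\<^sup>m\<^sup>-\<^sup>1\<close> through the factor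
  \<open>(1 - e)\<^sup>m\<^sup>-\<^sup>1\<close>, which Bernoulli's inequality keeps within \<open>(m - 1) e\<close> of one. The Lipschitz
  bound on \<open>phi_FB\<close> then makes the squared residual quadratically small.
\<close>

lemma Phi_FB_shrink_bound:
  assumes "u \<in> SOL m q A"
  obtains K where "0 \<le> K"
    and "\<And>e. 0 \<le> e \<Longrightarrow> e \<le> 1 \<Longrightarrow> (norm (Phi_FB m q A ((1 - e) *\<^sub>R u)))\<^sup>2 \<le> K * e\<^sup>2"
proof
  let ?w = "tensor_apply m A u"
  define C where "C i = 2 * (\<bar>u $ i\<bar> + real (m - 1) * \<bar>?w $ i\<bar>)" for i
  show "0 \<le> (\<Sum>i\<in>UNIV. (C i)\<^sup>2)"
    by (simp add: sum_nonneg)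
  fix e :: real
  assume e: "0 \<le> e" "e \<le> 1"
  define r where "r = (1 - e) ^ (m - 1)"
  have r: "\<bar>r - 1\<bar> \<le> real (m - 1) * e"
    using Bernoulli_inequality[of "- e" "m - 1"] power_le_one[of "1 - e" "m - 1"] e
    by (simp add: r_def)
  have comp: "\<bar>Phi_FB m q A ((1 - e) *\<^sub>R u) $ i\<bar> \<le> C i * e" for i
  proof -
    have "\<bar>Phi_FB m q A ((1 - e) *\<^sub>R u) $ i\<bar>
        = \<bar>phi_FB ((1 - e) * u $ i) (q $ i + r * ?w $ i) - phi_FB (u $ i) (q $ i + ?w $ i)\<bar>"
      by (simp add: Phi_FB_def tensor_apply_scaleR r_def phi_FB_eq_0 SOL_componentwise[OF assms])
    also have "\<dots> \<le> 2 * (\<bar>(1 - e) * u $ i - u $ i\<bar> + \<bar>q $ i + r * ?w $ i - (q $ i + ?w $ i)\<bar>)"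
      by (rule phi_FB_Lipschitz)
    also have "\<dots> = 2 * (\<bar>(- e) * u $ i\<bar> + \<bar>(r - 1) * ?w $ i\<bar>)"
      by (simp add: algebra_simps)
    also have "\<dots> = 2 * (e * \<bar>u $ i\<bar> + \<bar>r - 1\<bar> * \<bar>?w $ i\<bar>)"
      using e by (simp add: abs_mult)
    also have "\<dots> \<le> 2 * (e * \<bar>u $ i\<bar> + real (m - 1) * e * \<bar>?w $ i\<bar>)"
      using mult_right_mono[OF r, of "\<bar>?w $ i\<bar>"] by simp
    also have "\<dots> = C i * e"
      by (simp add: C_def algebra_simps)
    finally show ?thesis .
  qed
  have "(norm (Phi_FB m q A ((1 - e) *\<^sub>R u)))\<^sup>2
      = (\<Sum>i\<in>UNIV. (Phi_FB m q A ((1 - e) *\<^sub>R u) $ i)\<^sup>2)"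
    by (simp add: norm_vec_def L2_set_def sum_nonneg)
  also have "\<dots> \<le> (\<Sum>i\<in>UNIV. (C i * e)\<^sup>2)"
    using comp by (intro sum_mono) (metis abs_ge_zero power2_abs power_mono)
  also have "\<dots> = (\<Sum>i\<in>UNIV. (C i)\<^sup>2) * e\<^sup>2"
    by (simp add: power_mult_distrib sum_distrib_right)
  finally show "(norm (Phi_FB m q A ((1 - e) *\<^sub>R u)))\<^sup>2 \<le> (\<Sum>i\<in>UNIV. (C i)\<^sup>2) * e\<^sup>2" .
qed

text \<open>
  Shrinking a solution costs \<open>O(e\<^sup>2)\<close> in the residual and gains a multiple of \<open>e\<close> in the penalty.
  This turns the possibly weak inequality between \<open>ubar\<close> and the origin into a strict one.
\<close>

lemma SOL_strict_descent:
  assumes "u \<in> SOL m q A" "u \<noteq> 0" "0 < p" "p < 1" "0 < t"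
  shows "\<exists>y. objective m A q p t y < objective m A q p t u"
proof -
  obtain K where K: "0 \<le> K"
    and bound: "\<And>e. 0 \<le> e \<Longrightarrow> e \<le> 1 \<Longrightarrow> (norm (Phi_FB m q A ((1 - e) *\<^sub>R u)))\<^sup>2 \<le> K * e\<^sup>2"
    using Phi_FB_shrink_bound[OF assms(1)] by blast
  define g where "g = t * lp_pow p u * p"
  have g: "0 < g"
    using assms lp_pow_pos[of u p] by (simp add: g_def)
  \<comment> \<open>With this step \<open>e < 1\<close>, and \<open>K * e\<close> stays below the rate \<open>g\<close> at which the penalty drops;
    the denominator \<open>K + 1\<close> covers \<open>K = 0\<close>.\<close>
  define e where "e = min (1 / 2) (g / (K + 1))"
  have e: "0 < e" "e < 1"
    using g K by (auto simp: e_def)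
  have "K * e \<le> K * (g / (K + 1))"
    using K by (intro mult_left_mono) (auto simp: e_def)
  also have "\<dots> < g"
    using K g by (simp add: field_simps)
  finally have "1 / 2 * (K * e) < g"
    using g by simp
  then have quadratic: "1 / 2 * (K * e\<^sup>2) < g * e"
    using mult_strict_right_mono[of "1 / 2 * (K * e)" g e] e by (simp add: power2_eq_square)
  have "lp_pow p ((1 - e) *\<^sub>R u) \<le> (1 - p * e) * lp_pow p u"
    using one_minus_powr_le[of p e] assms e lp_pow_pos[of u p]
    by (simp add: lp_pow_scaleR mult_right_mono)
  then have "t * lp_pow p ((1 - e) *\<^sub>R u) \<le> t * ((1 - p * e) * lp_pow p u)"
    using assms by (intro mult_left_mono) auto
  also have "\<dots> = t * lp_pow p u - g * e"
    by (simp add: g_def algebra_simps)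
  finally have "objective m A q p t ((1 - e) *\<^sub>R u) < t * lp_pow p u"
    using bound[of e] e quadratic unfolding objective_def by linarith
  then show ?thesis
    using objective_SOL[OF assms(1), of p t] by auto
qed

theorem theorem3p7:
  fixes m :: nat
    and A :: "'n::finite list \<Rightarrow> real"
    and q ustar u0 :: "real ^ 'n"
    and p t :: real
  assumes "m \<ge> 2"
    and "A \<in> tensors m"
    and "0 < p" and "p < 1"
    and "t > 0"
    and "local_minimizer (objective m A q p t) ustar"
    and "objective m A q p t ustar \<le> objective m A q p t u0"
    and "\<exists>ubar \<in> SOL m q A. ubar \<noteq> 0 \<and> t \<le> 2 * (norm (q_tilde q))\<^sup>2 / lp_pow p ubar"
  shows "\<not> global_minimizer (objective m A q p t) 0"
proof -
  obtain ubar where ubar: "ubar \<in> SOL m q A" "ubar \<noteq> 0"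
    and t: "t \<le> 2 * (norm (q_tilde q))\<^sup>2 / lp_pow p ubar"
    using assms by blast
  have "t * lp_pow p ubar \<le> 2 * (norm (q_tilde q))\<^sup>2"
    using t lp_pow_pos[OF ubar(2), of p] by (simp add: pos_le_divide_eq)
  then have "objective m A q p t ubar \<le> objective m A q p t 0"
    by (simp add: objective_SOL[OF ubar(1)] objective_zero[OF \<open>m \<ge> 2\<close>])
  moreover obtain y where "objective m A q p t y < objective m A q p t ubar"
    using SOL_strict_descent[OF ubar \<open>0 < p\<close> \<open>p < 1\<close> \<open>t > 0\<close>] by blast
  ultimately show ?thesis
    unfolding global_minimizer_def by (meson leD less_le_trans)
qed

end
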